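(* Let the prior $P$ be uniform on $\mathcal{H}=\{h_1,\dots,h_H\}$ and let $\phi\in\{\mathrm{lin},\mathrm{sq},\mathrm{kl}\}$. For determining the (global) optimal posterior, i.e. the minimizer of $B_{\phi,\chi^2}$ over $\Delta^H$, it is sufficient to compare the bound values corresponding to the best posteriors on the ordered subsets $\mathcal{H}_{\mathrm{ord}}(H')=\{h_1,\dots,h_{H'}\}$, $H'=1,\dots,H$, of $\mathcal{H}$ ranked by non-decreasing $\hat l_i$ values; that is, $$\inf_{Q\in\Delta^H}B_{\phi,\chi^2}(Q)=\min_{1\le H'\le H}\ \inf\{B_{\phi,\chi^2}(Q): Q\in\Delta^H,\ q_i>0 \text{ if and only if } i\le H'\}.$$ These ordered subsets are uniquely identified by their size: $H'\mapsto\mathcal{H}_{\mathrm{ord}}(H')$ is a bijection between $\{1,\dots,H\}$ and the family of ordered increasing subsets of $\mathcal{H}$.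
   Context: $\mathcal{H}=\{h_1,\dots,h_H\}$ is a finite set of classifiers with empirical risks in $[0,1]$ indexed so that $\hat l_1\le\dots\le\hat l_H$; $m\ge1$ is an integer (sample size), $\delta\in(0,1)$, and $\Delta^H=\{(q_1,\dots,q_H):q_i\ge0,\ \sum_i q_i=1\}$. With uniform prior, for $Q\in\Delta^H$: $B_{\mathrm{lin},\chi^2}(Q)=\sum_{i=1}^H\hat l_iq_i+\sqrt{\frac{H\sum_i q_i^2}{4m\delta}}$, $B_{\mathrm{sq},\chi^2}(Q)=\sum_{i=1}^H\hat l_iq_i+\sqrt[4]{H\left(\sum_iq_i^2\right)\frac{12m-11}{16m^3\delta}}$, $B_{\mathrm{kl},\chi^2}(Q)=\sup\left\{r\in(0,1): kl\left(\sum_i\hat l_iq_i,r\right)\le\sqrt{\frac{H(\sum_iq_i^2)\,\mathcal{I}^R_{\mathrm{kl}}(m,2)}{\delta}}\right\}$, where $kl(a,b)=a\ln\frac ab+(1-a)\ln\frac{1-a}{1-b}$ (with $0\ln0=0$) and $\mathcal{I}^R_{\mathrm{kl}}(m,2)=\sup_{l\in[0,1]}\sum_{k=0}^m\binom mk l^k(1-l)^{m-k}\left(kl\left(\tfrac km,l\right)\right)^2$ (terms with zero binomial weight are taken to be $0$). The family of ordered increasing subsets of $\mathcal{H}$ is $\{h_1\},\{h_1,h_2\},\dots,\{h_1,\dots,h_H\}$. *)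

theory Defs
  imports Complex_Main
begin

text \<open>
  Throughout, \<open>N\<close> is the number of classifiers, \<open>l i\<close> the empirical risk of the
  \<open>i\<close>-th classifier (\<open>1 \<le> i \<le> N\<close>), \<open>m\<close> the sample size and \<open>\<delta>\<close> the confidence parameter.
\<close>

text \<open>A posterior is a weight function on the indices, extended by 0 outside \<open>{1..N}\<close>.\<close>

definition simplex :: "nat \<Rightarrow> (nat \<Rightarrow> real) set" where
  "simplex N = {q. (\<forall>i\<in>{1..N}. q i \<ge> 0) \<and> (\<forall>i. i \<notin> {1..N} \<longrightarrow> q i = 0) \<and> (\<Sum>i=1..N. q i) = 1}"

definition simplex_support_upto :: "nat \<Rightarrow> nat \<Rightarrow> (nat \<Rightarrow> real) set" where
  "simplex_support_upto N n = {q \<in> simplex N. \<forall>i\<in>{1..N}. q i > 0 \<longleftrightarrow> i \<le> n}"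

text \<open>
  The convention \<open>0 ln 0 = 0\<close> holds automatically. The value is meaningful for
  \<open>0 \<le> a \<le> 1\<close> and \<open>0 < b < 1\<close>, and at \<open>a = b \<in> {0, 1}\<close>.
\<close>

definition kl :: "real \<Rightarrow> real \<Rightarrow> real" where
  "kl a b = a * ln (a / b) + (1 - a) * ln ((1 - a) / (1 - b))"

text \<open>
  At \<open>l = 0\<close> and \<open>l = 1\<close> the terms in which \<^const>\<open>kl\<close> would be infinite have binomial weight 0,
  hence are 0. The family of sums is bounded, so the supremum over the reals is the true one.
\<close>

definition I_kl_R2 :: "nat \<Rightarrow> real" where
  "I_kl_R2 m = (SUP l\<in>{0..1}.
     \<Sum>k=0..m. real (m choose k) * l ^ k * (1 - l) ^ (m - k) * (kl (real k / real m) l)\<^sup>2)"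

text \<open>
  The factor \<open>N * (\<Sum>i=1..N. (q i)\<^sup>2)\<close> in the bounds below is \<open>\<Sum>i=1..N. (q i)\<^sup>2 / p i\<close>
  (one plus the chi-squared divergence) for the uniform prior \<open>p i = 1 / N\<close>.
\<close>

definition B_lin :: "nat \<Rightarrow> (nat \<Rightarrow> real) \<Rightarrow> nat \<Rightarrow> real \<Rightarrow> (nat \<Rightarrow> real) \<Rightarrow> real" where
  "B_lin N l m \<delta> q =
     (\<Sum>i=1..N. l i * q i) + sqrt (real N * (\<Sum>i=1..N. (q i)\<^sup>2) / (4 * real m * \<delta>))"

definition B_sq :: "nat \<Rightarrow> (nat \<Rightarrow> real) \<Rightarrow> nat \<Rightarrow> real \<Rightarrow> (nat \<Rightarrow> real) \<Rightarrow> real" where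
  "B_sq N l m \<delta> q =
     (\<Sum>i=1..N. l i * q i)
     + root 4 (real N * (\<Sum>i=1..N. (q i)\<^sup>2) * ((12 * real m - 11) / (16 * real m ^ 3 * \<delta>)))"

definition B_kl :: "nat \<Rightarrow> (nat \<Rightarrow> real) \<Rightarrow> nat \<Rightarrow> real \<Rightarrow> (nat \<Rightarrow> real) \<Rightarrow> real" where
  "B_kl N l m \<delta> q =
     Sup {r \<in> {0<..<1}. kl (\<Sum>i=1..N. l i * q i) r
                         \<le> sqrt (real N * (\<Sum>i=1..N. (q i)\<^sup>2) * I_kl_R2 m / \<delta>)}"

datatype distance_kind = Lin | Sq | Kl

fun B_chi2 :: "distance_kind \<Rightarrow> nat \<Rightarrow> (nat \<Rightarrow> real) \<Rightarrow> nat \<Rightarrow> real \<Rightarrow> (nat \<Rightarrow> real) \<Rightarrow> real" where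
  "B_chi2 Lin = B_lin"
| "B_chi2 Sq = B_sq"
| "B_chi2 Kl = B_kl"

definition H_ord :: "(nat \<Rightarrow> 'c) \<Rightarrow> nat \<Rightarrow> 'c set" where
  "H_ord h n = {h i | i. 1 \<le> i \<and> i \<le> n}"

definition ordered_increasing_subsets :: "(nat \<Rightarrow> 'c) \<Rightarrow> nat \<Rightarrow> 'c set set" where
  "ordered_increasing_subsets h N = {H_ord h n | n. 1 \<le> n \<and> n \<le> N}"

end

theory Submission
  imports Defs "HOL-Library.Infinite_Set"
begin

text \<open>
  Each of the three bounds depends on a posterior \<open>q\<close> only through its mean risk
  \<open>\<Sum>i. l i * q i\<close> and its sum of squares \<open>\<Sum>i. (q i)\<^sup>2\<close>, and for a fixed sum of squares it is
  non-decreasing in the mean risk. So it suffices to turn an arbitrary posterior into one supported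
  on an initial segment without changing the sum of squares and without raising the mean risk. This
  is done by sliding the positive weights to the left: if the support is
  \<open>s\<^sub>1 < \<dots> < s\<^sub>n\<close>, give the weight \<open>q (s\<^sub>i)\<close> to the index \<open>i\<close>. As
  \<open>i \<le> s\<^sub>i\<close> and the risks are sorted, every weight meets a risk no larger than before
  (lemma \<open>compress_support\<close>). Working with one posterior at a time in this way avoids
  convexity and the existence of minimizers.

  The monotonicity is immediate for the linear and the squared distance. For the \<open>kl\<close> bound it
  comes from \<open>kl a r\<close> being antitone in \<open>a\<close> below \<open>r\<close> (lemma \<open>kl_antimono_left\<close>). There is one
  delicate point: when the mean risk is \<open>0\<close> or \<open>1\<close>, the set whose supremum defines the bound is
  nonempty only if the threshold for \<open>kl\<close> is strictly positive. This requires
  \<open>I_kl_R2 m > 0\<close>, which in turn needs the boundedness of the family under its supremum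
  (lemma \<open>I_kl_summand_le\<close>).
\<close>

section \<open>Binary relative entropy\<close>

text \<open>Gibbs' inequality, from \<open>ln x \<le> x - 1\<close>.\<close>

lemma kl_nonneg:
  assumes "0 \<le> a" "a \<le> 1" "0 < b" "b < 1"
  shows "0 \<le> kl a b"
proof -
  have *: "x - y \<le> x * ln (x / y)" if "0 \<le> x" "0 < y" for x y :: real
  proof (cases "x = 0")
    case False
    then have "ln (y / x) \<le> y / x - 1"
      using that by (intro ln_le_minus_one) auto
    then have "x * ln (y / x) \<le> x * (y / x - 1)"
      using that by (intro mult_left_mono) auto
    then show ?thesis
      using that False by (simp add: ln_div algebra_simps)
  qed (use that in auto)
  show ?thesis
    using *[of a b] *[of "1 - a" "1 - b"] assms unfolding kl_def by simp
qed

lemma kl_self: "0 < a \<Longrightarrow> a < 1 \<Longrightarrow> kl a a = 0"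
  by (simp add: kl_def)

text \<open>
  The three-point identity of \<open>kl\<close> as a Bregman divergence. It yields monotonicity in the first
  argument from Gibbs' inequality alone, including at the boundary \<open>a = 0\<close>, where \<open>kl\<close> is not
  differentiable.
\<close>

lemma kl_three_point:
  assumes "0 \<le> a" "a \<le> 1" "0 < b" "b < 1" "0 < r" "r < 1"
  shows "kl a r = kl b r + kl a b + (b - a) * (ln (r / b) + ln ((1 - b) / (1 - r)))"
proof -
  have *: "x * ln (x / z) = x * ln (x / y) + x * ln (y / z)"
    if "0 \<le> x" "0 < y" "0 < z" for x y z :: real
    using that by (cases "x = 0") (auto simp: ln_div algebra_simps)
  have "ln (r / b) = - ln (b / r)"
    using assms by (simp add: ln_div)
  then show ?thesis
    using *[of a b r] *[of "1 - a" "1 - b" "1 - r"] assms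
    unfolding kl_def by (simp add: algebra_simps)
qed

lemma kl_antimono_left:
  assumes "0 \<le> a" "a \<le> b" "b < r" "r < 1"
  shows "kl b r \<le> kl a r"
proof (cases "b = 0")
  case False
  then have b: "0 < b" "b < 1" and r: "0 < r"
    using assms by auto
  have "0 \<le> ln (r / b) + ln ((1 - b) / (1 - r))"
    using b r assms by (intro add_nonneg_nonneg ln_ge_zero) auto
  then have "0 \<le> (b - a) * (ln (r / b) + ln ((1 - b) / (1 - r)))"
    using assms by simp
  moreover have "0 \<le> kl a b"
    using assms b by (intro kl_nonneg) auto
  ultimately show ?thesis
    using kl_three_point[of a b r] assms b r by simp
qed (use assms in auto)

section \<open>Positivity of the moment constant\<close>

lemma mult_ln_square_le:
  fixes y :: real
  assumes "0 < y" "y < 1"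
  shows "y * (ln y)\<^sup>2 \<le> 4"
proof -
  have y: "0 < sqrt y" "sqrt y < 1"
    using assms by auto
  have "- ln (sqrt y) \<le> 1 / sqrt y - 1"
    using ln_le_minus_one[of "1 / sqrt y"] y by (simp add: ln_div)
  moreover have "ln y = 2 * ln (sqrt y)"
    using assms by (simp add: ln_sqrt)
  ultimately have "- ln y \<le> 2 / sqrt y"
    by simp
  moreover have "0 \<le> - ln y"
    using assms by simp
  ultimately have "(- ln y)\<^sup>2 \<le> (2 / sqrt y)\<^sup>2"
    by (intro power_mono)
  then have "(ln y)\<^sup>2 \<le> 4 / y"
    using assms by (simp add: power_divide)
  then have "y * (ln y)\<^sup>2 \<le> y * (4 / y)"
    using assms by (intro mult_left_mono) auto
  then show ?thesis
    using assms by simp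
qed

text \<open>
  Dropping the entropy terms, \<open>kl x l\<close> is at most the convex combination of \<open>- ln l\<close> and
  \<open>- ln (1 - l)\<close> with weights \<open>x\<close> and \<open>1 - x\<close>, so its square is at most the same combination of
  the squares. A logarithm enters with nonzero weight only if a factor \<open>l\<close> (respectively
  \<open>1 - l\<close>) is present in the binomial weight to control it.
\<close>

lemma I_kl_summand_le:
  fixes l :: real
  assumes "1 \<le> m" "k \<le> m" "0 \<le> l" "l \<le> 1"
  shows "l ^ k * (1 - l) ^ (m - k) * (kl (real k / real m) l)\<^sup>2 \<le> 4"
proof -
  consider "l = 0" | "l = 1" | "0 < l" "l < 1"
    using assms by linarith
  then show ?thesis
  proof cases
    case 1
    then show ?thesis by (cases "k = 0") (auto simp: kl_def power_0_left)
  next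
    case 2
    then show ?thesis using assms by (cases "k = m") (auto simp: kl_def power_0_left)
  next
    case 3
    define x where "x = real k / real m"
    have x: "0 \<le> x" "x \<le> 1"
      using assms by (auto simp: x_def)
    define w where "w = l ^ k * (1 - l) ^ (m - k)"
    have w0: "0 \<le> w"
      using 3 by (simp add: w_def)
    have *: "y * ln (y / z) \<le> y * - ln z" if "0 \<le> y" "y \<le> 1" "0 < z" for y z :: real
      using that mult_nonneg_nonpos[of y "ln y"]
      by (cases "y = 0") (auto simp: ln_div algebra_simps)
    have "kl x l \<le> x * - ln l + (1 - x) * - ln (1 - l)"
      unfolding kl_def using *[of x l] *[of "1 - x" "1 - l"] x 3 by linarith
    moreover have "0 \<le> kl x l"
      using x 3 by (intro kl_nonneg) auto
    ultimately have "(kl x l)\<^sup>2 \<le> (x * - ln l + (1 - x) * - ln (1 - l))\<^sup>2"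
      by (intro power_mono)
    also have "\<dots> = x * (ln l)\<^sup>2 + (1 - x) * (ln (1 - l))\<^sup>2 - x * (1 - x) * (ln l - ln (1 - l))\<^sup>2"
      by (simp add: algebra_simps power2_eq_square)
    also have "\<dots> \<le> x * (ln l)\<^sup>2 + (1 - x) * (ln (1 - l))\<^sup>2"
      using x by simp
    finally have "w * (kl x l)\<^sup>2 \<le> w * (x * (ln l)\<^sup>2 + (1 - x) * (ln (1 - l))\<^sup>2)"
      using w0 by (rule mult_left_mono)
    also have "\<dots> = x * (w * (ln l)\<^sup>2) + (1 - x) * (w * (ln (1 - l))\<^sup>2)"
      by (simp add: algebra_simps)
    also have "\<dots> \<le> x * 4 + (1 - x) * 4"
    proof (intro add_mono)
      show "x * (w * (ln l)\<^sup>2) \<le> x * 4"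
      proof (cases "k = 0")
        case False
        have "w \<le> l ^ k"
          unfolding w_def using 3 by (intro mult_left_le power_le_one) auto
        also have "\<dots> \<le> l"
          using False 3 power_decreasing[of 1 k l] by simp
        finally have "w * (ln l)\<^sup>2 \<le> l * (ln l)\<^sup>2"
          by (intro mult_right_mono) auto
        then have "w * (ln l)\<^sup>2 \<le> 4"
          using mult_ln_square_le[of l] 3 by linarith
        then show ?thesis
          using x by (intro mult_left_mono)
      qed (simp add: x_def)
      show "(1 - x) * (w * (ln (1 - l))\<^sup>2) \<le> (1 - x) * 4"
      proof (cases "k = m")
        case False
        have "w \<le> (1 - l) ^ (m - k)"
          unfolding w_def using 3 by (intro mult_left_le_one_le power_le_one) auto
        also have "\<dots> \<le> 1 - l"
          using False assms 3 power_decreasing[of 1 "m - k" "1 - l"] by simp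
        finally have "w * (ln (1 - l))\<^sup>2 \<le> (1 - l) * (ln (1 - l))\<^sup>2"
          by (intro mult_right_mono) auto
        then have "w * (ln (1 - l))\<^sup>2 \<le> 4"
          using mult_ln_square_le[of "1 - l"] 3 by linarith
        then show ?thesis
          using x by (intro mult_left_mono) auto
      qed (use assms in \<open>simp add: x_def\<close>)
    qed
    finally show ?thesis
      by (simp add: w_def x_def)
  qed
qed

lemma I_kl_R2_pos:
  assumes "1 \<le> m"
  shows "0 < I_kl_R2 m"
proof -
  define f where "f l = (\<Sum>k=0..m. real (m choose k) * l ^ k * (1 - l) ^ (m - k)
    * (kl (real k / real m) l)\<^sup>2)" for l :: real
  have "f l \<le> (\<Sum>k=0..m. real (m choose k) * 4)" if "l \<in> {0..1}" for l
    unfolding f_def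
  proof (rule sum_mono)
    fix k assume "k \<in> {0..m}"
    then show "real (m choose k) * l ^ k * (1 - l) ^ (m - k) * (kl (real k / real m) l)\<^sup>2
        \<le> real (m choose k) * 4"
      using mult_left_mono[OF I_kl_summand_le[of m k l], of "real (m choose k)"] that assms
      by (simp add: mult.assoc)
  qed
  then have bdd: "bdd_above (f ` {0..1})"
    by (intro bdd_aboveI2)
  \<comment> \<open>At \<open>l = 1/2\<close> the summand \<open>k = 0\<close> is \<open>(ln 2)\<^sup>2 / 2 ^ m\<close>.\<close>
  have "0 < real (m choose 0) * (1/2) ^ 0 * (1 - 1/2) ^ (m - 0) * (kl (real 0 / real m) (1/2))\<^sup>2"
    by (simp add: kl_def)
  also have "\<dots> \<le> f (1/2)"
    unfolding f_def by (rule member_le_sum) auto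
  also have "\<dots> \<le> (SUP l\<in>{0..1}. f l)"
    by (rule cSUP_upper[OF _ bdd]) auto
  also have "\<dots> = I_kl_R2 m"
    by (simp add: I_kl_R2_def f_def)
  finally show ?thesis .
qed

section \<open>The upper inverse of the relative entropy\<close>

text \<open>
  With \<open>c = 0\<close> this would fail for \<open>a \<in> {0, 1}\<close>. For such \<open>a\<close> the witnesses solve
  \<open>kl a r = c\<close> exactly.
\<close>

lemma kl_sublevel_nonempty:
  assumes "0 \<le> a" "a \<le> 1" "0 < c"
  shows "{r \<in> {0<..<1}. kl a r \<le> c} \<noteq> {}"
proof -
  consider "a = 0" | "a = 1" | "0 < a" "a < 1"
    using assms by linarith
  then show ?thesis
  proof cases
    case 1
    then have "1 - exp (- c) \<in> {r \<in> {0<..<1}. kl a r \<le> c}"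
      using assms by (simp add: kl_def ln_div)
    then show ?thesis by blast
  next
    case 2
    then have "exp (- c) \<in> {r \<in> {0<..<1}. kl a r \<le> c}"
      using assms by (simp add: kl_def ln_div)
    then show ?thesis by blast
  next
    case 3
    then have "a \<in> {r \<in> {0<..<1}. kl a r \<le> c}"
      using assms by (simp add: kl_self)
    then show ?thesis by blast
  qed
qed

lemma kl_sublevel_bdd: "bdd_above {r \<in> {0<..<1}. kl a r \<le> c}"
  by (rule bdd_aboveI[of _ 1]) auto

lemma kl_upper_inverse_nonneg:
  assumes "0 \<le> a" "a \<le> 1" "0 < c"
  shows "0 \<le> Sup {r \<in> {0<..<1}. kl a r \<le> c}"
proof -
  obtain r where r: "r \<in> {r \<in> {0<..<1}. kl a r \<le> c}"
    using kl_sublevel_nonempty[OF assms] by blast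
  then have "r \<le> Sup {r \<in> {0<..<1}. kl a r \<le> c}"
    by (rule cSup_upper[OF _ kl_sublevel_bdd])
  with r show ?thesis by simp
qed

text \<open>
  A point \<open>r > b\<close> of the sublevel set of \<open>a\<close> also lies in that of \<open>b\<close>, since \<open>kl\<close> is antitone to
  the left of \<open>r\<close>. A point \<open>r \<le> b\<close> is dominated by \<open>b\<close> itself, or for \<open>b = 1\<close>
  by some point of the sublevel set between \<open>r\<close> and \<open>1\<close>.
\<close>

lemma kl_upper_inverse_mono:
  assumes "0 \<le> a" "a \<le> b" "b \<le> 1" "0 < c"
  shows "Sup {r \<in> {0<..<1}. kl a r \<le> c} \<le> Sup {r \<in> {0<..<1}. kl b r \<le> c}"
proof (rule cSup_mono)
  show "{r \<in> {0<..<1}. kl a r \<le> c} \<noteq> {}"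
    using assms by (intro kl_sublevel_nonempty) auto
  show "bdd_above {r \<in> {0<..<1}. kl b r \<le> c}"
    by (rule kl_sublevel_bdd)
  fix r assume "r \<in> {r \<in> {0<..<1}. kl a r \<le> c}"
  then have r: "0 < r" "r < 1" "kl a r \<le> c"
    by auto
  consider "b < r" | "r \<le> b" "b < 1" | "b = 1"
    using assms by linarith
  then show "\<exists>r'\<in>{r \<in> {0<..<1}. kl b r \<le> c}. r \<le> r'"
  proof cases
    case 1
    then have "kl b r \<le> c"
      using kl_antimono_left[of a b r] assms r by linarith
    with r show ?thesis by auto
  next
    case 2
    then show ?thesis
      using assms r by (intro bexI[of _ b]) (auto simp: kl_self)
  next
    case 3
    have "- ln (max r (exp (- c))) \<le> - ln (exp (- c))"
      using r by (simp only: neg_le_iff_le, intro ln_mono) auto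
    then have "kl b (max r (exp (- c))) \<le> c"
      using r 3 assms(4) by (simp add: kl_def ln_div)
    moreover have "max r (exp (- c)) \<in> {0<..<1}"
      using r assms by auto
    ultimately show ?thesis
      by (intro bexI[of _ "max r (exp (- c))"]) auto
  qed
qed

section \<open>Monotonicity of the bounds in the mean risk\<close>

lemma simplex_mean_bounds:
  assumes "q \<in> simplex N" "\<And>i. i \<in> {1..N} \<Longrightarrow> 0 \<le> l i \<and> l i \<le> 1"
  shows "0 \<le> (\<Sum>i=1..N. l i * q i)" "(\<Sum>i=1..N. l i * q i) \<le> 1"
proof -
  have q: "\<And>i. i \<in> {1..N} \<Longrightarrow> 0 \<le> q i" "(\<Sum>i=1..N. q i) = 1"
    using assms(1) by (auto simp: simplex_def)
  show "0 \<le> (\<Sum>i=1..N. l i * q i)"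
    using q assms(2) by (intro sum_nonneg mult_nonneg_nonneg) auto
  have "(\<Sum>i=1..N. l i * q i) \<le> (\<Sum>i=1..N. q i)"
    using q assms(2) by (intro sum_mono mult_left_le_one_le) auto
  then show "(\<Sum>i=1..N. l i * q i) \<le> 1"
    using q by simp
qed

lemma simplex_sum_squares_pos:
  assumes "q \<in> simplex N"
  shows "0 < (\<Sum>i=1..N. (q i)\<^sup>2)"
proof -
  have "(\<Sum>i=1..N. q i) \<noteq> 0"
    using assms by (simp add: simplex_def)
  then obtain i where "i \<in> {1..N}" "q i \<noteq> 0"
    by (meson sum.neutral)
  then show ?thesis
    by (intro sum_pos2[of _ i]) auto
qed

lemma kl_threshold_pos:
  assumes "1 \<le> N" "1 \<le> m" "0 < \<delta>" "q \<in> simplex N"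
  shows "0 < sqrt (real N * (\<Sum>i=1..N. (q i)\<^sup>2) * I_kl_R2 m / \<delta>)"
  using assms simplex_sum_squares_pos[OF assms(4)] I_kl_R2_pos[of m] by simp

lemma B_chi2_nonneg:
  assumes "1 \<le> N" "1 \<le> m" "0 < \<delta>" "q \<in> simplex N"
    and l: "\<And>i. i \<in> {1..N} \<Longrightarrow> 0 \<le> l i \<and> l i \<le> 1"
  shows "0 \<le> B_chi2 \<phi> N l m \<delta> q"
proof (cases \<phi>)
  case Lin
  then show ?thesis
    using simplex_mean_bounds[OF assms(4) l] simplex_sum_squares_pos[OF assms(4)] assms
    by (simp add: B_lin_def)
next
  case Sq
  have "0 \<le> root 4 (real N * (\<Sum>i=1..N. (q i)\<^sup>2) * ((12 * real m - 11) / (16 * real m ^ 3 * \<delta>)))"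
    using simplex_sum_squares_pos[OF assms(4)] assms
    by (intro real_root_ge_zero mult_nonneg_nonneg divide_nonneg_nonneg) auto
  with Sq show ?thesis
    using simplex_mean_bounds[OF assms(4) l] by (simp add: B_sq_def)
next
  case Kl
  then show ?thesis
    using simplex_mean_bounds[OF assms(4) l] kl_threshold_pos[OF assms(1-4)]
    by (simp only: B_chi2.simps B_kl_def kl_upper_inverse_nonneg)
qed

lemma B_chi2_mono_mean:
  assumes "1 \<le> N" "1 \<le> m" "0 < \<delta>" and q: "q \<in> simplex N" "q' \<in> simplex N"
    and l: "\<And>i. i \<in> {1..N} \<Longrightarrow> 0 \<le> l i \<and> l i \<le> 1"
    and mean: "(\<Sum>i=1..N. l i * q' i) \<le> (\<Sum>i=1..N. l i * q i)"
    and squares: "(\<Sum>i=1..N. (q' i)\<^sup>2) = (\<Sum>i=1..N. (q i)\<^sup>2)"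
  shows "B_chi2 \<phi> N l m \<delta> q' \<le> B_chi2 \<phi> N l m \<delta> q"
proof (cases \<phi>)
  case Kl
  have "Sup {r \<in> {0<..<1}. kl (\<Sum>i=1..N. l i * q' i) r
        \<le> sqrt (real N * (\<Sum>i=1..N. (q i)\<^sup>2) * I_kl_R2 m / \<delta>)}
      \<le> Sup {r \<in> {0<..<1}. kl (\<Sum>i=1..N. l i * q i) r
        \<le> sqrt (real N * (\<Sum>i=1..N. (q i)\<^sup>2) * I_kl_R2 m / \<delta>)}"
    using simplex_mean_bounds(1)[OF q(2) l] mean simplex_mean_bounds(2)[OF q(1) l]
      kl_threshold_pos[OF assms(1-4)] by (rule kl_upper_inverse_mono)
  then show ?thesis
    by (simp only: Kl B_chi2.simps B_kl_def squares)
qed (use mean squares in \<open>simp_all add: B_lin_def B_sq_def\<close>)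

section \<open>Compression of the support\<close>

lemma simplex_support_upto_nonempty:
  assumes "n \<in> {1..N}"
  shows "simplex_support_upto N n \<noteq> {}"
proof -
  define u :: "nat \<Rightarrow> real" where "u i = (if i \<in> {1..n} then 1 / real n else 0)" for i
  have "(\<Sum>i=1..N. u i) = (\<Sum>i=1..n. 1 / real n)"
    using assms by (intro sum.mono_neutral_cong_right) (auto simp: u_def)
  then have "u \<in> simplex_support_upto N n"
    using assms by (auto simp: simplex_support_upto_def simplex_def u_def)
  then show ?thesis by blast
qed

lemma Suc_le_enumerate:
  assumes "finite S" "0 \<notin> S" "k < card S"
  shows "Suc k \<le> enumerate S k"
  using assms(3)
proof (induction k)
  case 0
  then have "enumerate S 0 \<in> S"
    using assms by (intro finite_enumerate_in_set)
  then show ?case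
    using assms(2) by (cases "enumerate S 0") auto
next
  case (Suc k)
  then have "enumerate S k < enumerate S (Suc k)"
    using assms by (intro finite_enumerate_mono) auto
  with Suc show ?case by simp
qed

text \<open>
  The new weights are those on the support of \<open>q\<close>, slid to the left in their order. The function
  \<open>enumerate\<close> counts from \<open>0\<close>, so the index \<open>i\<close> receives the weight of
  \<open>enumerate S (i - 1)\<close>, an index at least \<open>i\<close>.
\<close>

lemma compress_support:
  fixes l :: "nat \<Rightarrow> real"
  assumes q: "q \<in> simplex N"
    and mono: "\<And>i j. 1 \<le> i \<Longrightarrow> i \<le> j \<Longrightarrow> j \<le> N \<Longrightarrow> l i \<le> l j"
  obtains n q' where "n \<in> {1..N}" "q' \<in> simplex_support_upto N n"
    "(\<Sum>i=1..N. l i * q' i) \<le> (\<Sum>i=1..N. l i * q i)"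
    "(\<Sum>i=1..N. (q' i)\<^sup>2) = (\<Sum>i=1..N. (q i)\<^sup>2)"
proof -
  define S where "S = {i \<in> {1..N}. 0 < q i}"
  define n where "n = card S"
  define s where "s i = enumerate S (i - 1)" for i
  define q' where "q' i = (if i \<in> {1..n} then q (s i) else 0)" for i
  have fin: "finite S" and S: "S \<subseteq> {1..N}"
    by (auto simp: S_def)
  have q0: "q i = 0" if "i \<in> {1..N} - S" for i
    using q that by (force simp: S_def simplex_def)
  have "bij_betw (\<lambda>i. i - 1) {1..n} {..<n}"
    by (rule bij_betw_byWitness[of _ Suc]) auto
  then have bij: "bij_betw s {1..n} S"
    using bij_betw_trans[OF _ finite_bij_enumerate[OF fin]]
    by (simp add: n_def s_def[abs_def] comp_def)
  have sS: "s i \<in> S" if "i \<in> {1..n}" for i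
    using bij that by (auto dest: bij_betwE)
  have i_le_s: "i \<le> s i" if "i \<in> {1..n}" for i
  proof -
    have "0 \<notin> S"
      using S by auto
    then show ?thesis
      using Suc_le_enumerate[OF fin, of "i - 1"] that by (auto simp: s_def n_def)
  qed
  have nN: "n \<le> N"
    using card_mono[OF _ S] by (simp add: n_def)
  \<comment> \<open>Sums of functions vanishing with the weight can be moved between \<open>q'\<close> and \<open>q\<close>.\<close>
  have q'_sum: "(\<Sum>i=1..N. F i (q' i)) = (\<Sum>i=1..n. F i (q (s i)))"
    if "\<And>i. F i 0 = 0" for F :: "nat \<Rightarrow> real \<Rightarrow> real"
    using nN that by (intro sum.mono_neutral_cong_right) (auto simp: q'_def)
  have q_sum: "(\<Sum>i=1..N. F i (q i)) = (\<Sum>i=1..n. F (s i) (q (s i)))"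
    if "\<And>i. F i 0 = 0" for F :: "nat \<Rightarrow> real \<Rightarrow> real"
  proof -
    have "(\<Sum>i=1..N. F i (q i)) = (\<Sum>i\<in>S. F i (q i))"
      using S q0 that by (intro sum.mono_neutral_right) auto
    also have "\<dots> = (\<Sum>i=1..n. F (s i) (q (s i)))"
      by (rule sum.reindex_bij_betw[OF bij, symmetric])
    finally show ?thesis .
  qed
  have "(\<Sum>i=1..N. q i) = 1"
    using q by (simp add: simplex_def)
  then have total: "(\<Sum>i=1..N. q' i) = 1"
    using q'_sum[of "\<lambda>_ x. x"] q_sum[of "\<lambda>_ x. x"] by simp
  have "n \<noteq> 0"
  proof
    assume "n = 0"
    then have "(\<Sum>i=1..N. q' i) = 0"
      by (simp add: q'_def)
    with total show False by simp
  qed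
  have pos: "0 < q' i" if "i \<in> {1..n}" for i
    using sS[OF that] that by (simp add: q'_def S_def)
  have "q' \<in> simplex N"
    using total pos nN unfolding simplex_def by (auto simp: q'_def less_imp_le)
  then have supp: "q' \<in> simplex_support_upto N n"
    using pos by (auto simp: simplex_support_upto_def q'_def)
  have "(\<Sum>i=1..N. l i * q' i) = (\<Sum>i=1..n. l i * q (s i))"
    using q'_sum[of "\<lambda>i x. l i * x"] by simp
  also have "\<dots> \<le> (\<Sum>i=1..n. l (s i) * q (s i))"
  proof (intro sum_mono mult_right_mono)
    fix i assume i: "i \<in> {1..n}"
    have "s i \<in> {1..N}" "0 < q (s i)"
      using sS[OF i] by (auto simp: S_def)
    then show "l i \<le> l (s i)" "0 \<le> q (s i)"
      using mono[of i "s i"] i_le_s[OF i] i by auto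
  qed
  also have "\<dots> = (\<Sum>i=1..N. l i * q i)"
    using q_sum[of "\<lambda>i x. l i * x"] by simp
  finally have mean: "(\<Sum>i=1..N. l i * q' i) \<le> (\<Sum>i=1..N. l i * q i)" .
  have "(\<Sum>i=1..N. (q' i)\<^sup>2) = (\<Sum>i=1..N. (q i)\<^sup>2)"
    using q'_sum[of "\<lambda>_ x. x\<^sup>2"] q_sum[of "\<lambda>_ x. x\<^sup>2"] by simp
  with \<open>n \<noteq> 0\<close> nN supp mean show ?thesis
    by (intro that[of n q']) auto
qed

section \<open>Optimality of ordered subsets\<close>

lemma card_H_ord:
  assumes "inj_on h {1..N}" "n \<le> N"
  shows "card (H_ord h n) = n"
proof -
  have "H_ord h n = h ` {1..n}"
    by (auto simp: H_ord_def)
  moreover have "inj_on h {1..n}"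
    using assms by (auto intro: inj_on_subset)
  ultimately show ?thesis
    by (simp add: card_image)
qed

theorem corollary1:
  fixes \<H> :: "'c set" and h :: "nat \<Rightarrow> 'c" and risk :: "'c \<Rightarrow> real"
    and N m :: nat and \<delta> :: real and \<phi> :: distance_kind
  assumes "N \<ge> 1"
    and "bij_betw h {1..N} \<H>"
    and "\<And>c. c \<in> \<H> \<Longrightarrow> 0 \<le> risk c \<and> risk c \<le> 1"
    and "\<And>i j. 1 \<le> i \<Longrightarrow> i \<le> j \<Longrightarrow> j \<le> N \<Longrightarrow> risk (h i) \<le> risk (h j)"
    and "m \<ge> 1"
    and "0 < \<delta>" and "\<delta> < 1"
  shows "(INF q\<in>simplex N. B_chi2 \<phi> N (\<lambda>i. risk (h i)) m \<delta> q)
           = Min ((\<lambda>H'. INF q\<in>simplex_support_upto N H'. B_chi2 \<phi> N (\<lambda>i. risk (h i)) m \<delta> q) ` {1..N})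
         \<and> bij_betw (H_ord h) {1..N} (ordered_increasing_subsets h N)"
proof
  define l where "l i = risk (h i)" for i
  define B where "B = B_chi2 \<phi> N l m \<delta>"
  have l: "0 \<le> l i \<and> l i \<le> 1" if "i \<in> {1..N}" for i
    using assms(2,3) that by (auto simp: l_def dest: bij_betwE)
  have sub: "simplex_support_upto N n \<subseteq> simplex N" for n
    by (auto simp: simplex_support_upto_def)
  have "0 \<le> B q" if "q \<in> simplex N" for q
    unfolding B_def using B_chi2_nonneg[OF assms(1,5,6) that l] .
  then have bdd: "bdd_below (B ` simplex N)"
    by (intro bdd_belowI2)
  then have bdd': "bdd_below (B ` simplex_support_upto N n)" for n
    using sub by (meson bdd_below_mono image_mono)
  have nonempty: "simplex_support_upto N n \<noteq> {}" if "n \<in> {1..N}" for n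
    using that by (rule simplex_support_upto_nonempty)
  let ?M = "(\<lambda>n. INF q\<in>simplex_support_upto N n. B q) ` {1..N}"
  have "(INF q\<in>simplex N. B q) = Min ?M"
  proof (rule antisym)
    have "(INF q\<in>simplex N. B q) \<le> (INF q\<in>simplex_support_upto N n. B q)" if "n \<in> {1..N}" for n
      using nonempty[OF that] bdd sub by (intro cINF_superset_mono) auto
    then show "(INF q\<in>simplex N. B q) \<le> Min ?M"
      using assms(1) by (intro Min.boundedI) auto
    show "Min ?M \<le> (INF q\<in>simplex N. B q)"
    proof (rule cINF_greatest)
      show "simplex N \<noteq> {}"
        using nonempty[of 1] sub[of 1] assms(1) by auto
      fix q assume q: "q \<in> simplex N"
      obtain n q' where n: "n \<in> {1..N}" and q': "q' \<in> simplex_support_upto N n"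
        and mean: "(\<Sum>i=1..N. l i * q' i) \<le> (\<Sum>i=1..N. l i * q i)"
        and squares: "(\<Sum>i=1..N. (q' i)\<^sup>2) = (\<Sum>i=1..N. (q i)\<^sup>2)"
        using compress_support[OF q, of l] assms(4) by (auto simp: l_def)
      have "Min ?M \<le> (INF q\<in>simplex_support_upto N n. B q)"
        using n by (intro Min_le) auto
      also have "\<dots> \<le> B q'"
        using bdd' q' by (rule cINF_lower)
      also have "\<dots> \<le> B q"
        unfolding B_def using q q' sub l mean squares assms(1,5,6)
        by (intro B_chi2_mono_mean) auto
      finally show "Min ?M \<le> B q" .
    qed
  qed
  then show "(INF q\<in>simplex N. B_chi2 \<phi> N (\<lambda>i. risk (h i)) m \<delta> q)
      = Min ((\<lambda>H'. INF q\<in>simplex_support_upto N H'. B_chi2 \<phi> N (\<lambda>i. risk (h i)) m \<delta> q) ` {1..N})"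
    by (simp add: B_def l_def[abs_def])
  have "inj_on (H_ord h) {1..N}"
    using card_H_ord[OF bij_betw_imp_inj_on[OF assms(2)]]
    by (intro inj_on_inverseI[of _ card]) auto
  moreover have "H_ord h ` {1..N} = ordered_increasing_subsets h N"
    by (auto simp: ordered_increasing_subsets_def)
  ultimately show "bij_betw (H_ord h) {1..N} (ordered_increasing_subsets h N)"
    by (simp add: bij_betw_def)
qed

end
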